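(* The sharp symmetrized free Talagrand inequality implies the free functional Santaló inequality. That is, suppose that for every centered compactly supported Borel probability measure $\mu$ on $\mathbb{R}$ and every compactly supported Borel probability measure $\nu$ on $\mathbb{R}$ one has $$W_2(\mu,\nu)^2\le 2H(\mu,\sigma)+2H(\nu,\sigma),$$ where $\sigma$ is the standard semicircular law. Then for all continuous functions $f,g:\mathbb{R}\to\mathbb{R}$ such that $f(x)+g(y)\ge xy$ for all $x,y\in\mathbb{R}$ and such that the free Gibbs measure $\nu_f$ (or $\nu_g$) has barycenter zero, one has $$e^{\chi_f(\nu_f)+\chi_g(\nu_g)}\le2\pi.$$
   Context: $W_2$ is the usual quadratic Wasserstein distance between probability measures on $\mathbb{R}$. A measure $\mu$ is centered (has barycenter zero) if $\int x\,d\mu(x)=0$. The standard semicircular law $\sigma$ has density $\frac1{2\pi}\sqrt{4-x^2}$ on $[-2,2]$. The free entropy of a Borel probability measure $\mu$ on $\mathbb{R}$ is $$\chi(\mu)=\iint\log|t-s|\,d\mu(s)\,d\mu(t)+\tfrac34+\tfrac12\log(2\pi)\in[-\infty,\infty),$$ and $$H(\mu,\sigma)=\tfrac12\int x^2\,d\mu(x)-\chi(\mu)+\tfrac12\log(2\pi).$$ For a potential $u:\mathbb{R}\to\mathbb{R}$, set $\chi_u(\mu)=\chi(\mu)-\int u\,d\mu$. The free Gibbs measure $\nu_u$ is the unique maximizer of $\chi_u$ over Borel probability measures on $\mathbb{R}$. It exists and is compactly supported whenever $u$ is lower semi-continuous and $\lim_{|x|\to\infty}(u(x)-2\log|x|)=+\infty$.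 *)

theory Defs
  imports "HOL-Probability.Probability"
begin

text \<open>Borel probability measures on the real line are rendered by the library locale
  \<^locale>\<open>real_distribution\<close>.\<close>

definition compactly_supported :: "real measure \<Rightarrow> bool" where
  "compactly_supported \<mu> \<longleftrightarrow> (\<exists>K. compact K \<and> (AE x in \<mu>. x \<in> K))"

definition centered :: "real measure \<Rightarrow> bool" where
  "centered \<mu> \<longleftrightarrow> integrable \<mu> (\<lambda>x. x) \<and> (\<integral>x. x \<partial>\<mu>) = 0"

definition couplings :: "real measure \<Rightarrow> real measure \<Rightarrow> (real \<times> real) measure set" where
  "couplings \<mu> \<nu> =
     {\<pi>. prob_space \<pi> \<and> sets \<pi> = sets (borel \<Otimes>\<^sub>M borel)
         \<and> distr \<pi> borel fst = \<mu> \<and> distr \<pi> borel snd = \<nu>}"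

text \<open>The square of the quadratic Wasserstein distance.\<close>

definition W2_sq :: "real measure \<Rightarrow> real measure \<Rightarrow> ennreal" where
  "W2_sq \<mu> \<nu> = (INF \<pi> \<in> couplings \<mu> \<nu>. \<integral>\<^sup>+ (x, y). ennreal ((x - y)\<^sup>2) \<partial>\<pi>)"

text \<open>The integral of an extended-real function, as the difference of the integrals of its
  positive and negative parts.  The undefined case \<open>\<infinity> - \<infinity>\<close> is given the value \<open>-\<infinity>\<close>
  (the plain difference in \<^typ>\<open>ereal\<close> would make it \<open>\<infinity>\<close>).\<close>

definition ext_integral :: "'a measure \<Rightarrow> ('a \<Rightarrow> ereal) \<Rightarrow> ereal" where
  "ext_integral M h =
     (if (\<integral>\<^sup>+ x. e2ennreal (- h x) \<partial>M) = \<infinity> then - \<infinity>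
      else enn2ereal (\<integral>\<^sup>+ x. e2ennreal (h x) \<partial>M) - enn2ereal (\<integral>\<^sup>+ x. e2ennreal (- h x) \<partial>M))"

text \<open>\<open>log |x|\<close> with \<open>log 0 = -\<infinity>\<close>, whereas the library has \<open>ln 0 = 0\<close>.  In particular a
  measure with an atom has free entropy \<open>-\<infinity>\<close>.\<close>

definition log_abs :: "real \<Rightarrow> ereal" where
  "log_abs x = (if x = 0 then - \<infinity> else ereal (ln \<bar>x\<bar>))"

definition free_entropy :: "real measure \<Rightarrow> ereal" where
  "free_entropy \<mu> =
     ext_integral (\<mu> \<Otimes>\<^sub>M \<mu>) (\<lambda>(t, s). log_abs (t - s)) + ereal (3 / 4 + ln (2 * pi) / 2)"

text \<open>\<open>H(\<mu>, \<sigma>)\<close>, the free entropy of \<open>\<mu>\<close> relative to the standard semicircular law \<open>\<sigma>\<close>; the law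
  \<open>\<sigma>\<close> enters only through its quadratic potential and the additive constant.\<close>

definition free_entropy_rel_semicircle :: "real measure \<Rightarrow> ereal" where
  "free_entropy_rel_semicircle \<mu> =
     ext_integral \<mu> (\<lambda>x. ereal (x\<^sup>2)) / 2 - free_entropy \<mu> + ereal (ln (2 * pi) / 2)"

text \<open>\<open>\<chi>\<^sub>u(\<mu>) = \<chi>(\<mu>) - \<integral> u d\<mu>\<close>.  The value is \<open>-\<infinity>\<close> as soon as \<open>\<chi>(\<mu>) = -\<infinity>\<close> or the positive
  part of \<open>u\<close> has infinite integral.  When \<open>u(x) - 2 log |x|\<close> tends to \<open>\<infinity>\<close> at infinity (and
  \<open>u\<close> is bounded below), any \<open>\<mu>\<close> with tails so heavy that \<open>\<chi>(\<mu>)\<close> becomes infinite or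
  ambiguous has \<open>\<integral> u d\<mu> = \<infinity>\<close>, so it gets the value \<open>-\<infinity>\<close> and is not a competitor below.\<close>

definition free_entropy_pot :: "(real \<Rightarrow> real) \<Rightarrow> real measure \<Rightarrow> ereal" where
  "free_entropy_pot u \<mu> =
     (if free_entropy \<mu> = - \<infinity> \<or> (\<integral>\<^sup>+ x. ennreal (u x) \<partial>\<mu>) = \<infinity> then - \<infinity>
      else free_entropy \<mu> - ext_integral \<mu> (\<lambda>x. ereal (u x)))"

definition is_free_gibbs_measure :: "(real \<Rightarrow> real) \<Rightarrow> real measure \<Rightarrow> bool" where
  "is_free_gibbs_measure u \<nu> \<longleftrightarrow>
     real_distribution \<nu> \<and>
     (\<forall>\<mu>. real_distribution \<mu> \<longrightarrow> free_entropy_pot u \<mu> \<le> free_entropy_pot u \<nu>) \<and>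
     (\<forall>\<mu>. real_distribution \<mu> \<and> free_entropy_pot u \<mu> = free_entropy_pot u \<nu> \<longrightarrow> \<mu> = \<nu>)"

definition exp_ereal :: "ereal \<Rightarrow> ereal" where
  "exp_ereal x = (case x of ereal r \<Rightarrow> ereal (exp r) | PInfty \<Rightarrow> \<infinity> | MInfty \<Rightarrow> 0)"

end

theory Submission
  imports Defs
begin

text \<open>For any coupling \<open>\<pi>\<close> of \<open>\<mu>\<close> and \<open>\<nu>\<close>, the bound \<open>x y \<le> f x + g y\<close> gives
  \<open>\<integral>(x - y)\<^sup>2 d\<pi> \<ge> \<integral>x\<^sup>2 d\<mu> + \<integral>y\<^sup>2 d\<nu> - 2 (\<integral>f d\<mu> + \<integral>g d\<nu>)\<close>.  Combined with the Talagrand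
  inequality, the second moments cancel and \<open>\<chi>\<^sub>f(\<mu>) + \<chi>\<^sub>g(\<nu>) \<le> log (2 \<pi>)\<close> remains.

  If \<open>\<mu>\<close> is not centered, translating it by its barycenter \<open>m\<close> and replacing \<open>f, g\<close> by
  \<open>f(x + m), g(y) - m y\<close>, again an admissible pair, adds only the error
  \<open>- (\<integral>x d\<mu>) (\<integral>y d\<nu>)\<close>.  So one can obtain compact supports by conditioning both Gibbs
  measures on \<open>[-n, n]\<close>, without caring about the barycenters, and let \<open>n\<close> tend to infinity: the error tends to the
  product of the barycenters of the Gibbs measures, which is zero.\<close>

section \<open>Integrals of extended-real functions\<close>

lemma ext_integral_eq_integral:
  fixes k :: "'a \<Rightarrow> real"
  assumes k: "integrable M k" and h: "AE x in M. h x = ereal (k x)"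
  shows "ext_integral M h = ereal (\<integral>x. k x \<partial>M)"
proof -
  have p: "(\<integral>\<^sup>+ x. e2ennreal (h x) \<partial>M) = (\<integral>\<^sup>+ x. ennreal (k x) \<partial>M)"
    by (rule nn_integral_cong_AE) (use h in \<open>auto simp: ennreal.abs_eq\<close>)
  have n: "(\<integral>\<^sup>+ x. e2ennreal (- h x) \<partial>M) = (\<integral>\<^sup>+ x. ennreal (- k x) \<partial>M)"
    by (rule nn_integral_cong_AE) (use h in \<open>auto simp: ennreal.abs_eq\<close>)
  have fp: "(\<integral>\<^sup>+ x. ennreal (k x) \<partial>M) \<noteq> \<infinity>" and fn: "(\<integral>\<^sup>+ x. ennreal (- k x) \<partial>M) \<noteq> \<infinity>"
    using k by (auto simp: real_integrable_def)
  obtain a where a: "a \<ge> 0" "(\<integral>\<^sup>+ x. ennreal (k x) \<partial>M) = ennreal a"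
    using fp by (metis ennreal_cases infinity_ennreal_def)
  obtain b where b: "b \<ge> 0" "(\<integral>\<^sup>+ x. ennreal (- k x) \<partial>M) = ennreal b"
    using fn by (metis ennreal_cases infinity_ennreal_def)
  show ?thesis
    unfolding ext_integral_def p n using k a b
    by (simp add: real_lebesgue_integral_def enn2ereal_ennreal)
qed

text \<open>An infinite negative part would give the value \<open>- \<infinity>\<close> by
  convention; with a finite negative part, an infinite positive part would give
  \<open>\<infinity>\<close>. Hence both parts have finite integral, and so \<open>h\<close> is
  finite almost everywhere.\<close>

lemma ext_integral_finiteD:
  assumes h [measurable]: "h \<in> borel_measurable M"
    and "ext_integral M h \<noteq> \<infinity>" "ext_integral M h \<noteq> - \<infinity>"
  shows "AE x in M. h x = ereal (real_of_ereal (h x))"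
    and "integrable M (\<lambda>x. real_of_ereal (h x))"
proof -
  have fn: "(\<integral>\<^sup>+ x. e2ennreal (- h x) \<partial>M) \<noteq> \<infinity>"
    using assms(3) by (auto simp: ext_integral_def)
  then obtain b where b: "b \<ge> 0" "(\<integral>\<^sup>+ x. e2ennreal (- h x) \<partial>M) = ennreal b"
    by (metis ennreal_cases infinity_ennreal_def)
  have fp: "(\<integral>\<^sup>+ x. e2ennreal (h x) \<partial>M) \<noteq> \<infinity>"
    using assms(2) b by (auto simp: ext_integral_def enn2ereal_ennreal)
  have "AE x in M. e2ennreal (h x) \<noteq> \<infinity>" "AE x in M. e2ennreal (- h x) \<noteq> \<infinity>"
    by (rule nn_integral_noteq_infinite; use fn fp in simp)+
  then show fin: "AE x in M. h x = ereal (real_of_ereal (h x))"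
  proof eventually_elim
    case (elim x)
    then show ?case by (cases "h x") (auto simp: top_ereal_def)
  qed
  have "(\<integral>\<^sup>+ x. e2ennreal (h x) \<partial>M) = (\<integral>\<^sup>+ x. ennreal (real_of_ereal (h x)) \<partial>M)"
    by (rule nn_integral_cong_AE)
      (use fin in \<open>eventually_elim, metis ennreal.abs_eq e2ennreal_ereal\<close>)
  moreover have "(\<integral>\<^sup>+ x. e2ennreal (- h x) \<partial>M) = (\<integral>\<^sup>+ x. ennreal (- real_of_ereal (h x)) \<partial>M)"
    by (rule nn_integral_cong_AE)
      (use fin in \<open>eventually_elim, metis e2ennreal_ereal uminus_ereal.simps(1)\<close>)
  ultimately show "integrable M (\<lambda>x. real_of_ereal (h x))"
    unfolding real_integrable_def using fn fp by simp
qed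

section \<open>Measures of finite logarithmic energy\<close>

text \<open>Since \<open>ln 0 = 0\<close>, integrability alone would not notice atoms. The first
  conjunct makes the diagonal a null set, so that the real kernel agrees almost everywhere with
  \<open>log_abs\<close>.\<close>

definition finite_log_energy :: "real measure \<Rightarrow> bool" where
  "finite_log_energy \<mu> \<longleftrightarrow>
     (AE z in \<mu> \<Otimes>\<^sub>M \<mu>. fst z \<noteq> snd z) \<and> integrable (\<mu> \<Otimes>\<^sub>M \<mu>) (\<lambda>z. ln \<bar>fst z - snd z\<bar>)"

definition log_energy :: "real measure \<Rightarrow> real" where
  "log_energy \<mu> = (\<integral>z. ln \<bar>fst z - snd z\<bar> \<partial>(\<mu> \<Otimes>\<^sub>M \<mu>))"

lemma real_of_ereal_log_abs: "real_of_ereal (log_abs x) = ln \<bar>x\<bar>"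
  by (simp add: log_abs_def)

lemma borel_measurable_log_abs [measurable]: "log_abs \<in> borel_measurable borel"
  unfolding log_abs_def[abs_def] by measurable

lemma (in real_distribution) sets_pair_borel [measurable_cong]:
  "sets (M \<Otimes>\<^sub>M M) = sets (borel \<Otimes>\<^sub>M borel)"
  by (intro sets_pair_measure_cong) auto

lemma free_entropy_eq_log_energy:
  assumes "finite_log_energy \<mu>"
  shows "free_entropy \<mu> = ereal (log_energy \<mu> + 3 / 4 + ln (2 * pi) / 2)"
proof -
  have "ext_integral (\<mu> \<Otimes>\<^sub>M \<mu>) (\<lambda>(t, s). log_abs (t - s)) = ereal (log_energy \<mu>)"
    unfolding log_energy_def
    by (rule ext_integral_eq_integral)
      (use assms in \<open>auto simp: finite_log_energy_def log_abs_def split_beta\<close>)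
  then show ?thesis by (simp add: free_entropy_def)
qed

lemma (in real_distribution) finite_log_energyI:
  assumes "free_entropy M \<noteq> \<infinity>" "free_entropy M \<noteq> - \<infinity>"
  shows "finite_log_energy M"
proof -
  let ?h = "\<lambda>z. log_abs (fst z - snd z)"
  have h: "?h \<in> borel_measurable (M \<Otimes>\<^sub>M M)" by measurable
  have "ext_integral (M \<Otimes>\<^sub>M M) ?h \<noteq> \<infinity>" "ext_integral (M \<Otimes>\<^sub>M M) ?h \<noteq> - \<infinity>"
    using assms by (auto simp: free_entropy_def split_beta')
  note * = ext_integral_finiteD[OF h this]
  have "AE z in M \<Otimes>\<^sub>M M. fst z \<noteq> snd z"
    using *(1) by eventually_elim (auto simp: log_abs_def)
  then show ?thesis
    using *(2) by (simp add: finite_log_energy_def real_of_ereal_log_abs)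
qed

text \<open>A crude form of \<open>ln r \<le> r - 1\<close>: it makes a finite first moment control
  the positive part of the logarithmic kernel.\<close>

lemma ln_abs_diff_le: "ln \<bar>t - s :: real\<bar> \<le> \<bar>t\<bar> + \<bar>s\<bar>"
proof (cases "t = s")
  case False
  then have "ln \<bar>t - s\<bar> \<le> \<bar>t - s\<bar> - 1" by (intro ln_le_minus_one) auto
  then show ?thesis by linarith
qed auto

lemma (in real_distribution) free_entropy_less_top:
  assumes i: "integrable M (\<lambda>x. x)"
  shows "free_entropy M \<noteq> \<infinity>"
proof -
  interpret P: pair_sigma_finite M M ..
  have d1: "distr (M \<Otimes>\<^sub>M M) M fst = M" by (rule distr_pair_fst)
  have d2: "distr (M \<Otimes>\<^sub>M M) M snd = M"
    by (subst P.distr_pair_swap, subst distr_distr) (auto simp: comp_def split_beta distr_pair_fst)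
  have ia: "integrable M (\<lambda>x. \<bar>x\<bar>)" using i by auto
  have "integrable (M \<Otimes>\<^sub>M M) (\<lambda>z. \<bar>fst z\<bar>)"
    by (rule integrable_distr[of fst _ M]) (use ia d1 in auto)
  moreover have "integrable (M \<Otimes>\<^sub>M M) (\<lambda>z. \<bar>snd z\<bar>)"
    by (rule integrable_distr[of snd _ M]) (use ia d2 in auto)
  ultimately have "integrable (M \<Otimes>\<^sub>M M) (\<lambda>z. \<bar>fst z\<bar> + \<bar>snd z\<bar>)" by auto
  then have fin: "(\<integral>\<^sup>+ z. ennreal (\<bar>fst z\<bar> + \<bar>snd z\<bar>) \<partial>(M \<Otimes>\<^sub>M M)) \<noteq> \<infinity>"
    by (simp add: real_integrable_def)
  have "(\<integral>\<^sup>+ z. e2ennreal (log_abs (fst z - snd z)) \<partial>(M \<Otimes>\<^sub>M M))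
      \<le> (\<integral>\<^sup>+ z. ennreal (\<bar>fst z\<bar> + \<bar>snd z\<bar>) \<partial>(M \<Otimes>\<^sub>M M))"
  proof (rule nn_integral_mono)
    fix z :: "real \<times> real"
    \<comment> \<open>\<open>e2ennreal\<close> sends negative values and
      \<open>- \<infinity>\<close> to 0, so the bound also holds on the diagonal.\<close>
    show "e2ennreal (log_abs (fst z - snd z)) \<le> ennreal (\<bar>fst z\<bar> + \<bar>snd z\<bar>)"
      using ln_abs_diff_le[of "fst z" "snd z"]
      by (auto simp: log_abs_def e2ennreal_neg simp flip: ennreal_plus intro!: ennreal_leI)
  qed
  with fin have "(\<integral>\<^sup>+ z. e2ennreal (log_abs (fst z - snd z)) \<partial>(M \<Otimes>\<^sub>M M)) \<noteq> \<infinity>"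
    by (auto simp: top_unique)
  then have "ext_integral (M \<Otimes>\<^sub>M M) (\<lambda>(t, s). log_abs (t - s)) \<noteq> \<infinity>"
    by (auto simp: ext_integral_def split_beta ereal_minus_eq_PInfty_iff)
  then show ?thesis by (simp add: free_entropy_def)
qed

text \<open>The growth condition bounds \<open>u\<close> below by \<open>- b\<close>, and a value
  other than \<open>- \<infinity>\<close> makes the integral of its positive part finite. So
  \<open>u\<close> is integrable, hence so is \<open>x\<close>, which keeps the entropy below
  \<open>\<infinity>\<close>.\<close>

lemma (in real_distribution) free_entropy_pot_finiteD:
  fixes u :: "real \<Rightarrow> real"
  assumes u [measurable]: "u \<in> borel_measurable borel"
    and growth: "\<And>x. \<bar>x\<bar> \<le> u x + b"
    and pot: "free_entropy_pot u M \<noteq> - \<infinity>"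
  shows "integrable M (\<lambda>x. x)" "integrable M u" "finite_log_energy M"
    "free_entropy_pot u M = ereal (log_energy M + 3 / 4 + ln (2 * pi) / 2 - (\<integral>x. u x \<partial>M))"
proof -
  have ent: "free_entropy M \<noteq> - \<infinity>" and fu: "(\<integral>\<^sup>+ x. ennreal (u x) \<partial>M) \<noteq> \<infinity>"
    using pot by (auto simp: free_entropy_pot_def)
  have "(\<integral>\<^sup>+ x. ennreal (- u x) \<partial>M) \<le> (\<integral>\<^sup>+ x. ennreal b \<partial>M)"
    using growth by (intro nn_integral_mono ennreal_leI) (smt (verit))
  also have "\<dots> < \<infinity>" by (simp add: emeasure_space_1[simplified] ennreal_mult_less_top)
  finally show iu: "integrable M u"
    using fu by (auto simp: real_integrable_def)
  have "integrable M (\<lambda>x. u x + b)" using iu by auto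
  then show ix: "integrable M (\<lambda>x. x)"
    by (rule Bochner_Integration.integrable_bound) (use order_trans[OF growth abs_ge_self] in auto)
  show e: "finite_log_energy M"
    by (rule finite_log_energyI[OF free_entropy_less_top[OF ix] ent])
  show "free_entropy_pot u M = ereal (log_energy M + 3 / 4 + ln (2 * pi) / 2 - (\<integral>x. u x \<partial>M))"
    using fu iu by (simp add: free_entropy_pot_def free_entropy_eq_log_energy[OF e]
        ext_integral_eq_integral[of M u])
qed

section \<open>Translation and conditioning\<close>

text \<open>The kernel depends only on the difference of the coordinates, which a common shift
  preserves.\<close>

lemma (in real_distribution) log_energy_translate:
  fixes m :: real
  assumes e: "finite_log_energy M"
  defines "M' \<equiv> distr M borel (\<lambda>x. x - m)"
  shows "finite_log_energy M'" "log_energy M' = log_energy M"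
proof -
  interpret M': prob_space M' unfolding M'_def by (rule prob_space_distr) simp
  have s: "sigma_finite_measure (distr M borel (\<lambda>x. x - m))"
    using M'.sigma_finite_measure_axioms by (simp add: M'_def)
  have P: "M' \<Otimes>\<^sub>M M' = distr (M \<Otimes>\<^sub>M M) (borel \<Otimes>\<^sub>M borel) (\<lambda>(x, y). (x - m, y - m))"
    unfolding M'_def by (rule pair_measure_distr) (auto intro: s)
  have [measurable]: "(\<lambda>(x, y). (x - m, y - m)) \<in> M \<Otimes>\<^sub>M M \<rightarrow>\<^sub>M borel \<Otimes>\<^sub>M (borel :: real measure)"
    by measurable
  have [measurable]: "{z :: real \<times> real. fst z \<noteq> snd z} \<in> sets (borel \<Otimes>\<^sub>M borel)"
    using measurable_sets[of "\<lambda>z. fst z - snd z" "borel \<Otimes>\<^sub>M borel" borel "- {0 :: real}"]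
    by (simp add: vimage_def space_pair_measure)
  show "finite_log_energy M'"
    using e unfolding finite_log_energy_def P
    by (subst AE_distr_iff, simp_all add: integrable_distr_eq split_beta)
  show "log_energy M' = log_energy M"
    unfolding log_energy_def P by (subst integral_distr) (simp_all add: split_beta)
qed

lemma (in prob_space) integral_uniform_measure:
  fixes k :: "'a \<Rightarrow> real"
  assumes A [measurable]: "A \<in> events" and k: "integrable M k" and pos: "prob A > 0"
  shows "integrable (uniform_measure M A) k"
    and "(\<integral>x. k x \<partial>uniform_measure M A) = (\<integral>x. indicator A x * k x \<partial>M) / prob A"
proof -
  have [measurable]: "k \<in> borel_measurable M" using k by auto
  \<comment> \<open>The density is rewritten as \<open>ennreal\<close> of a real function, the form
    that the rules for Bochner integrals require.\<close>
  have U: "uniform_measure M A = density M (\<lambda>x. ennreal (indicator A x / prob A))"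
    unfolding uniform_measure_def
    by (rule density_cong)
      (use pos in \<open>auto simp: emeasure_eq_measure divide_ennreal split: split_indicator
        simp flip: ennreal_1\<close>)
  have i: "integrable M (\<lambda>x. indicator A x * k x)"
    using integrable_real_mult_indicator[OF A k] by (simp add: mult.commute)
  show "integrable (uniform_measure M A) k"
    unfolding U by (subst integrable_density) (use i pos in auto)
  show "(\<integral>x. k x \<partial>uniform_measure M A) = (\<integral>x. indicator A x * k x \<partial>M) / prob A"
    unfolding U by (subst integral_density) (use pos in auto)
qed

text \<open>Dominated convergence with majorant \<open>\<bar>k x\<bar>\<close> handles the integral
  over \<open>A n\<close>, and the normalizing factor \<open>prob (A n)\<close> tends to 1.\<close>

lemma (in prob_space) tendsto_integral_uniform_measure:
  fixes k :: "'a \<Rightarrow> real" and A :: "nat \<Rightarrow> 'a set"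
  assumes A [measurable]: "\<And>n. A n \<in> events" and "incseq A" and U: "(\<Union>n. A n) = space M"
    and k: "integrable M k"
  shows "eventually (\<lambda>n. prob (A n) > 0) sequentially"
    and "(\<lambda>n. \<integral>x. k x \<partial>uniform_measure M (A n)) \<longlonglongrightarrow> (\<integral>x. k x \<partial>M)"
proof -
  have [measurable]: "k \<in> borel_measurable M" using k by auto
  have "(\<lambda>n. prob (A n)) \<longlonglongrightarrow> prob (\<Union>n. A n)"
    by (rule finite_Lim_measure_incseq) (use assms in auto)
  then have p: "(\<lambda>n. prob (A n)) \<longlonglongrightarrow> 1" by (simp add: U prob_space)
  then show pos: "eventually (\<lambda>n. prob (A n) > 0) sequentially"
    by (rule order_tendstoD) simp
  have "(\<lambda>n. \<integral>x. indicator (A n) x * k x \<partial>M) \<longlonglongrightarrow> (\<integral>x. k x \<partial>M)"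
  proof (rule integral_dominated_convergence[where w = "\<lambda>x. \<bar>k x\<bar>"])
    show "AE x in M. (\<lambda>n. indicator (A n) x * k x) \<longlonglongrightarrow> k x"
    proof (rule AE_I2)
      fix x assume "x \<in> space M"
      then obtain N where "x \<in> A N" using U by auto
      then have "eventually (\<lambda>n. indicator (A n) x * k x = k x) sequentially"
        using \<open>incseq A\<close>
        by (intro eventually_sequentiallyI[of N]) (auto simp: incseq_def indicator_def)
      then show "(\<lambda>n. indicator (A n) x * k x) \<longlonglongrightarrow> k x"
        by (rule tendsto_eventually)
    qed
  qed (use k in \<open>auto split: split_indicator\<close>)
  from tendsto_divide[OF this p]
  have "(\<lambda>n. (\<integral>x. indicator (A n) x * k x \<partial>M) / prob (A n)) \<longlonglongrightarrow> (\<integral>x. k x \<partial>M)" by simp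
  moreover have "eventually (\<lambda>n. (\<integral>x. indicator (A n) x * k x \<partial>M) / prob (A n)
      = (\<integral>x. k x \<partial>uniform_measure M (A n))) sequentially"
    using pos by eventually_elim (simp add: integral_uniform_measure k)
  ultimately show "(\<lambda>n. \<integral>x. k x \<partial>uniform_measure M (A n)) \<longlonglongrightarrow> (\<integral>x. k x \<partial>M)"
    by (rule Lim_transform_eventually)
qed

text \<open>Reduces the logarithmic energy of a conditioned measure to an integral against a
  conditioned product measure, so that the general facts on conditioning apply to it.\<close>

lemma (in prob_space) pair_uniform_measure:
  assumes A [measurable]: "A \<in> events" and pos: "prob A > 0"
  shows "uniform_measure M A \<Otimes>\<^sub>M uniform_measure M A = uniform_measure (M \<Otimes>\<^sub>M M) (A \<times> A)"
proof -
  interpret P: pair_sigma_finite M M ..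
  have ps: "prob_space (uniform_measure M A)"
    using pos by (intro prob_space_uniform_measure) (auto simp: emeasure_eq_measure)
  have s: "sigma_finite_measure (density M (\<lambda>x. indicator A x / emeasure M A))"
    using prob_space_imp_sigma_finite[OF ps] by (simp add: uniform_measure_def)
  have e: "emeasure (M \<Otimes>\<^sub>M M) (A \<times> A) = ennreal (prob A * prob A)"
    by (subst emeasure_pair_measure_Times) (auto simp: emeasure_eq_measure ennreal_mult)
  show ?thesis
    unfolding uniform_measure_def e
    by (subst pair_measure_density[OF _ _ _ s])
      (use pos in \<open>auto intro!: density_cong AE_I2 sigma_finite_measure_axioms
        simp: emeasure_eq_measure divide_ennreal split: split_indicator
        simp flip: ennreal_1 ennreal_mult\<close>)
qed

lemma (in real_distribution) conditioning:
  fixes n :: nat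
  assumes pos: "prob {- real n..real n} > 0"
  defines "M' \<equiv> uniform_measure M {- real n..real n}"
  shows "real_distribution M'" "compactly_supported M'"
    and "finite_log_energy M \<Longrightarrow> finite_log_energy M'"
proof -
  interpret P: pair_prob_space M M ..
  have A [measurable]: "{- real n..real n} \<in> events" by simp
  interpret M': prob_space M'
    unfolding M'_def using pos
    by (intro prob_space_uniform_measure) (auto simp: emeasure_eq_measure)
  show "real_distribution M'"
    by standard (simp add: M'_def)
  have "AE x in M'. x \<in> {- real n..real n}"
    unfolding M'_def by (rule AE_uniform_measureI) auto
  then show "compactly_supported M'"
    unfolding compactly_supported_def by (intro exI[of _ "{- real n..real n}"]) auto
  show "finite_log_energy M'" if e: "finite_log_energy M"
  proof -
    have m: "P.prob ({- real n..real n} \<times> {- real n..real n}) > 0"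
      using pos by (simp add: measure_def emeasure_pair_measure_Times enn2real_mult)
    show ?thesis
      unfolding finite_log_energy_def M'_def pair_uniform_measure[OF A pos]
      using e m
      by (intro conjI AE_uniform_measureI P.integral_uniform_measure)
        (auto simp: finite_log_energy_def)
  qed
qed

lemma (in real_distribution) conditioning_tendsto:
  fixes k :: "real \<Rightarrow> real"
  shows "eventually (\<lambda>n. prob {- real n..real n} > 0) sequentially"
    and "integrable M k \<Longrightarrow>
      (\<lambda>n. \<integral>x. k x \<partial>uniform_measure M {- real n..real n}) \<longlonglongrightarrow> (\<integral>x. k x \<partial>M)"
    and "finite_log_energy M \<Longrightarrow>
      (\<lambda>n. log_energy (uniform_measure M {- real n..real n})) \<longlonglongrightarrow> log_energy M"
proof -
  interpret P: pair_prob_space M M ..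
  let ?A = "\<lambda>n. {- real n..real n}"
  have A: "?A n \<in> events" for n by simp
  have inc: "incseq ?A" by (auto simp: incseq_def)
  have bound: "\<exists>n. \<bar>x\<bar> \<le> real n" for x by (rule real_arch_simple)
  have U: "(\<Union>n. ?A n) = space M"
    using bound by (auto simp: abs_le_iff) (metis minus_le_iff)
  show pos: "eventually (\<lambda>n. prob (?A n) > 0) sequentially"
    by (rule tendsto_integral_uniform_measure(1)[OF A inc U, of "\<lambda>_. 0"]) simp
  show "integrable M k \<Longrightarrow> (\<lambda>n. \<integral>x. k x \<partial>uniform_measure M (?A n)) \<longlonglongrightarrow> (\<integral>x. k x \<partial>M)"
    by (rule tendsto_integral_uniform_measure(2)[OF A inc U])
  assume e: "finite_log_energy M"
  have "(\<lambda>n. \<integral>z. ln \<bar>fst z - snd z\<bar> \<partial>uniform_measure (M \<Otimes>\<^sub>M M) (?A n \<times> ?A n))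
      \<longlonglongrightarrow> (\<integral>z. ln \<bar>fst z - snd z\<bar> \<partial>(M \<Otimes>\<^sub>M M))"
  proof (rule P.tendsto_integral_uniform_measure(2))
    show "?A n \<times> ?A n \<in> P.events" for n using A by auto
    show "incseq (\<lambda>n. ?A n \<times> ?A n)" by (auto simp: incseq_def)
    \<comment> \<open>One \<open>n\<close> must serve both coordinates, hence the maximum of their
      absolute values.\<close>
    have "\<exists>n. fst z \<in> ?A n \<and> snd z \<in> ?A n" for z :: "real \<times> real"
      using bound[of "max \<bar>fst z\<bar> \<bar>snd z\<bar>"] by (auto simp: abs_le_iff) (metis minus_le_iff)
    then show "(\<Union>n. ?A n \<times> ?A n) = space (M \<Otimes>\<^sub>M M)"
      by (auto simp: space_pair_measure)
  qed (use e in \<open>simp add: finite_log_energy_def\<close>)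
  moreover have "eventually (\<lambda>n. (\<integral>z. ln \<bar>fst z - snd z\<bar> \<partial>uniform_measure (M \<Otimes>\<^sub>M M) (?A n \<times> ?A n))
      = log_energy (uniform_measure M (?A n))) sequentially"
    using pos by eventually_elim (simp add: log_energy_def pair_uniform_measure)
  ultimately show "(\<lambda>n. log_energy (uniform_measure M (?A n))) \<longlonglongrightarrow> log_energy M"
    unfolding log_energy_def[of M] by (rule Lim_transform_eventually)
qed

section \<open>The inequality for compactly supported measures\<close>

text \<open>A continuous function is bounded on the compact set that carries the measure.\<close>

lemma (in real_distribution) integrable_continuous_compactly_supported:
  fixes k :: "real \<Rightarrow> real"
  assumes "compactly_supported M" and k: "continuous_on UNIV k"
  shows "integrable M k"
proof -
  obtain K where K: "compact K" "AE x in M. x \<in> K"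
    using assms by (auto simp: compactly_supported_def)
  have "compact (k ` K)"
    using k K by (intro compact_continuous_image) (auto intro: continuous_on_subset)
  then obtain B where B: "\<And>x. x \<in> K \<Longrightarrow> norm (k x) \<le> B"
    by (meson compact_imp_bounded bounded_iff imageI)
  have [measurable]: "k \<in> borel_measurable borel"
    using k by (rule borel_measurable_continuous_onI)
  show ?thesis
    by (rule integrable_const_bound[where B = B]) (use K B in auto)
qed

text \<open>The easy half of Kantorovich duality: expand the square and bound the mixed term by
  \<open>F\<close> and \<open>G\<close>. If the lower bound is negative, \<open>ennreal\<close>
  turns it into 0.\<close>

lemma W2_sq_ge:
  fixes F G :: "real \<Rightarrow> real"
  assumes dual: "\<And>x y. x * y \<le> F x + G y"
    and \<mu>: "integrable \<mu> (\<lambda>x. x\<^sup>2)" "integrable \<mu> F"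
    and \<nu>: "integrable \<nu> (\<lambda>x. x\<^sup>2)" "integrable \<nu> G"
  shows "ennreal ((\<integral>x. x\<^sup>2 \<partial>\<mu>) + (\<integral>x. x\<^sup>2 \<partial>\<nu>) - 2 * ((\<integral>x. F x \<partial>\<mu>) + (\<integral>x. G x \<partial>\<nu>))) \<le> W2_sq \<mu> \<nu>"
    (is "ennreal ?L \<le> _")
  unfolding W2_sq_def
proof (rule INF_greatest)
  fix \<pi> assume "\<pi> \<in> couplings \<mu> \<nu>"
  then have s [measurable_cong]: "sets \<pi> = sets (borel \<Otimes>\<^sub>M borel)"
    and d: "distr \<pi> borel fst = \<mu>" "distr \<pi> borel snd = \<nu>"
    by (auto simp: couplings_def)
  have [measurable]: "fst \<in> \<pi> \<rightarrow>\<^sub>M borel" "snd \<in> \<pi> \<rightarrow>\<^sub>M borel" by measurable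
  have fst: "integrable \<pi> (\<lambda>z. h (fst z))" "(\<integral>z. h (fst z) \<partial>\<pi>) = (\<integral>x. h x \<partial>\<mu>)"
    if h: "integrable \<mu> h" for h :: "real \<Rightarrow> real"
  proof -
    have [measurable]: "h \<in> borel_measurable borel" using h d(1) by auto
    show "integrable \<pi> (\<lambda>z. h (fst z))"
      by (rule integrable_distr[of fst _ borel]) (use h d in auto)
    show "(\<integral>z. h (fst z) \<partial>\<pi>) = (\<integral>x. h x \<partial>\<mu>)"
      unfolding d(1)[symmetric] by (rule integral_distr[symmetric]) auto
  qed
  have snd: "integrable \<pi> (\<lambda>z. h (snd z))" "(\<integral>z. h (snd z) \<partial>\<pi>) = (\<integral>x. h x \<partial>\<nu>)"
    if h: "integrable \<nu> h" for h :: "real \<Rightarrow> real"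
  proof -
    have [measurable]: "h \<in> borel_measurable borel" using h d(2) by auto
    show "integrable \<pi> (\<lambda>z. h (snd z))"
      by (rule integrable_distr[of snd _ borel]) (use h d in auto)
    show "(\<integral>z. h (snd z) \<partial>\<pi>) = (\<integral>x. h x \<partial>\<nu>)"
      unfolding d(2)[symmetric] by (rule integral_distr[symmetric]) auto
  qed
  note i = fst(1)[OF \<mu>(1)] fst(1)[OF \<mu>(2)] snd(1)[OF \<nu>(1)] snd(1)[OF \<nu>(2)]
  note e = fst(2)[OF \<mu>(1)] fst(2)[OF \<mu>(2)] snd(2)[OF \<nu>(1)] snd(2)[OF \<nu>(2)]
  have sq: "integrable \<pi> (\<lambda>z. (fst z - snd z)\<^sup>2)"
  proof (rule Bochner_Integration.integrable_bound)
    show "integrable \<pi> (\<lambda>z. 2 * (fst z)\<^sup>2 + 2 * (snd z)\<^sup>2)" using i by auto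
    \<comment> \<open>The difference of the two sides is \<open>(x + y)\<^sup>2\<close>.\<close>
    have "(x - y)\<^sup>2 \<le> 2 * x\<^sup>2 + 2 * y\<^sup>2" for x y :: real
      using zero_le_power2[of "x + y"] by (simp add: power2_eq_square algebra_simps)
    then show "AE z in \<pi>. norm ((fst z - snd z)\<^sup>2) \<le> norm (2 * (fst z)\<^sup>2 + 2 * (snd z)\<^sup>2)"
      by auto
  qed measurable
  have "?L = (\<integral>z. (fst z)\<^sup>2 + (snd z)\<^sup>2 - 2 * (F (fst z) + G (snd z)) \<partial>\<pi>)"
    using i by (simp add: e)
  also have "\<dots> \<le> (\<integral>z. (fst z - snd z)\<^sup>2 \<partial>\<pi>)"
  proof (rule integral_mono)
    fix z show "(fst z)\<^sup>2 + (snd z)\<^sup>2 - 2 * (F (fst z) + G (snd z)) \<le> (fst z - snd z)\<^sup>2"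
      using dual[of "fst z" "snd z"] by (simp add: power2_diff)
  qed (use i sq in auto)
  finally have "ennreal ?L \<le> ennreal (\<integral>z. (fst z - snd z)\<^sup>2 \<partial>\<pi>)" by (rule ennreal_leI)
  also have "\<dots> = (\<integral>\<^sup>+ (x, y). ennreal ((x - y)\<^sup>2) \<partial>\<pi>)"
    using nn_integral_eq_integral[OF sq] by (simp add: split_beta')
  finally show "ennreal ?L \<le> (\<integral>\<^sup>+ (x, y). ennreal ((x - y)\<^sup>2) \<partial>\<pi>)" .
qed

text \<open>The term \<open>ln (2 * pi) / 2\<close> of the relative entropy cancels the one inside
  \<open>free_entropy\<close>, leaving only \<open>3 / 4\<close>.\<close>

lemma free_entropy_rel_semicircle_eq:
  assumes "finite_log_energy \<mu>" "integrable \<mu> (\<lambda>x. x\<^sup>2)"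
  shows "free_entropy_rel_semicircle \<mu> = ereal ((\<integral>x. x\<^sup>2 \<partial>\<mu>) / 2 - log_energy \<mu> - 3 / 4)"
  using assms by (simp add: free_entropy_rel_semicircle_def free_entropy_eq_log_energy
      ext_integral_eq_integral[where k = "\<lambda>x. x\<^sup>2"])

text \<open>The Talagrand inequality is applied to the centered translate of \<mu> and to \<nu>
  itself, with the pair \<open>f (x + m)\<close>, \<open>g y - m * y\<close>. The linear term
  integrates to the product of the barycenters.\<close>

lemma log_energy_sum_le:
  fixes f g :: "real \<Rightarrow> real"
  assumes talagrand:
    "\<And>\<mu> \<nu> :: real measure.
       real_distribution \<mu> \<Longrightarrow> compactly_supported \<mu> \<Longrightarrow> centered \<mu> \<Longrightarrow>
       real_distribution \<nu> \<Longrightarrow> compactly_supported \<nu> \<Longrightarrow>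
       enn2ereal (W2_sq \<mu> \<nu>)
         \<le> 2 * free_entropy_rel_semicircle \<mu> + 2 * free_entropy_rel_semicircle \<nu>"
    and f: "continuous_on UNIV f" and g: "continuous_on UNIV g"
    and dual: "\<And>x y. f x + g y \<ge> x * y"
    and \<mu>: "real_distribution \<mu>" "compactly_supported \<mu>" "finite_log_energy \<mu>"
    and \<nu>: "real_distribution \<nu>" "compactly_supported \<nu>" "finite_log_energy \<nu>"
  shows "log_energy \<mu> + log_energy \<nu> + 3 / 2
    \<le> (\<integral>x. f x \<partial>\<mu>) + (\<integral>x. g x \<partial>\<nu>) - (\<integral>x. x \<partial>\<mu>) * (\<integral>x. x \<partial>\<nu>)"
proof -
  interpret \<mu>: real_distribution \<mu> by fact
  interpret \<nu>: real_distribution \<nu> by fact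
  define m where "m = (\<integral>x. x \<partial>\<mu>)"
  define \<mu>' where "\<mu>' = distr \<mu> borel (\<lambda>x. x - m)"
  interpret \<mu>': prob_space \<mu>' unfolding \<mu>'_def by (rule \<mu>.prob_space_distr) simp
  interpret \<mu>': real_distribution \<mu>' by standard (simp add: \<mu>'_def)
  have f' [measurable]: "f \<in> borel_measurable borel"
    using f by (rule borel_measurable_continuous_onI)
  obtain K where K: "compact K" "AE x in \<mu>. x \<in> K"
    using \<mu> by (auto simp: compactly_supported_def)
  have K': "compact ((\<lambda>x. x - m) ` K)"
    using K by (intro compact_continuous_image continuous_intros)
  have "AE x in \<mu>. x - m \<in> (\<lambda>x. x - m) ` K"
    using K(2) by eventually_elim auto
  \<comment> \<open>The translated set is compact, hence closed and Borel, as the transfer along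
    \<open>distr\<close> requires.\<close>
  then have "AE x in \<mu>'. x \<in> (\<lambda>x. x - m) ` K"
    unfolding \<mu>'_def
    by (subst AE_distr_iff) (use compact_imp_closed[OF K'] in \<open>auto simp: borel_closed\<close>)
  with K' have cs: "compactly_supported \<mu>'" by (auto simp: compactly_supported_def)
  note int\<mu> = \<mu>.integrable_continuous_compactly_supported[OF \<mu>(2)]
    and int\<mu>' = \<mu>'.integrable_continuous_compactly_supported[OF cs]
    and int\<nu> = \<nu>.integrable_continuous_compactly_supported[OF \<nu>(2)]
  have "(\<integral>x. x \<partial>\<mu>') = (\<integral>x. x - m \<partial>\<mu>)" unfolding \<mu>'_def by (rule integral_distr) auto
  also have "\<dots> = 0" using int\<mu>[of "\<lambda>x. x"] by (simp add: m_def \<mu>.prob_space[simplified])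
  finally have cent: "centered \<mu>'"
    unfolding centered_def using int\<mu>'[of "\<lambda>x. x"] by simp
  note e' = \<mu>.log_energy_translate[OF \<mu>(3), of m, folded \<mu>'_def]
  have sq: "integrable \<mu>' (\<lambda>x. x\<^sup>2)" "integrable \<nu> (\<lambda>x. x\<^sup>2)"
    by (rule int\<mu>' int\<nu>; intro continuous_intros)+
  have F: "integrable \<mu>' (\<lambda>x. f (x + m))"
    by (intro int\<mu>' continuous_on_compose2[OF f] continuous_intros) auto
  have G: "integrable \<nu> (\<lambda>x. g x - m * x)"
    by (intro int\<nu> continuous_intros g)
  have F_eq: "(\<integral>x. f (x + m) \<partial>\<mu>') = (\<integral>x. f x \<partial>\<mu>)"
    unfolding \<mu>'_def by (subst integral_distr) auto
  have G_eq: "(\<integral>x. g x - m * x \<partial>\<nu>) = (\<integral>x. g x \<partial>\<nu>) - m * (\<integral>x. x \<partial>\<nu>)"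
    using int\<nu>[OF g] int\<nu>[of "\<lambda>x. x"] by simp
  have dual': "x * y \<le> f (x + m) + (g y - m * y)" for x y
    using dual[of "x + m" y] by (simp add: algebra_simps)
  have two: "2 * ereal r = ereal (2 * r)" for r
    by (metis numeral_eq_ereal times_ereal.simps(1))
  let ?L = "(\<integral>x. x\<^sup>2 \<partial>\<mu>') + (\<integral>x. x\<^sup>2 \<partial>\<nu>)
    - 2 * ((\<integral>x. f x \<partial>\<mu>) + ((\<integral>x. g x \<partial>\<nu>) - m * (\<integral>x. x \<partial>\<nu>)))"
  \<comment> \<open>\<open>?L\<close> may be negative; passing through \<open>ennreal\<close> then
    raises it to 0, which is the harmless direction.\<close>
  have "ereal ?L \<le> enn2ereal (ennreal ?L)"
    by (cases "0 \<le> ?L") (simp_all add: enn2ereal_ennreal ennreal_neg zero_ennreal.rep_eq)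
  also have "\<dots> \<le> enn2ereal (W2_sq \<mu>' \<nu>)"
    using W2_sq_ge[OF dual' sq(1) F sq(2) G] unfolding F_eq G_eq
    by (simp add: less_eq_ennreal.rep_eq)
  also have "\<dots> \<le> 2 * free_entropy_rel_semicircle \<mu>' + 2 * free_entropy_rel_semicircle \<nu>"
    by (rule talagrand[OF \<mu>'.real_distribution_axioms cs cent \<nu>(1,2)])
  \<comment> \<open>The second moments are the same as in \<open>?L\<close> and cancel; the
    logarithmic energy of \<open>\<mu>'\<close> is that of \<mu>.\<close>
  also have "\<dots> = ereal ((\<integral>x. x\<^sup>2 \<partial>\<mu>') + (\<integral>x. x\<^sup>2 \<partial>\<nu>) - 2 * (log_energy \<mu> + log_energy \<nu>) - 3)"
    by (simp add: free_entropy_rel_semicircle_eq e' sq \<nu>(3) two algebra_simps)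
  finally show ?thesis by (simp add: m_def algebra_simps)
qed

section \<open>The free functional Santalo inequality\<close>

text \<open>Taking \<open>y = 1\<close> and \<open>y = - 1\<close> gives at least linear growth, the
  source of the finite first moments.\<close>

lemma dual_growth:
  fixes f g :: "real \<Rightarrow> real"
  assumes "\<And>x y. f x + g y \<ge> x * y"
  shows "\<bar>x\<bar> \<le> f x + max (g 1) (g (- 1))"
  using assms[of x 1] assms[of x "- 1"] by auto

theorem proposition4:
  fixes f g :: "real \<Rightarrow> real" and \<nu>\<^sub>f \<nu>\<^sub>g :: "real measure"
  assumes talagrand:
    "\<And>\<mu> \<nu> :: real measure.
       real_distribution \<mu> \<Longrightarrow> compactly_supported \<mu> \<Longrightarrow> centered \<mu> \<Longrightarrow>
       real_distribution \<nu> \<Longrightarrow> compactly_supported \<nu> \<Longrightarrow>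
       enn2ereal (W2_sq \<mu> \<nu>)
         \<le> 2 * free_entropy_rel_semicircle \<mu> + 2 * free_entropy_rel_semicircle \<nu>"
  assumes "continuous_on UNIV f" and "continuous_on UNIV g"
    and "\<And>x y. f x + g y \<ge> x * y"
    and "is_free_gibbs_measure f \<nu>\<^sub>f" and "is_free_gibbs_measure g \<nu>\<^sub>g"
    and "centered \<nu>\<^sub>f \<or> centered \<nu>\<^sub>g"
  shows "exp_ereal (free_entropy_pot f \<nu>\<^sub>f + free_entropy_pot g \<nu>\<^sub>g) \<le> ereal (2 * pi)"
proof -
  interpret F: real_distribution \<nu>\<^sub>f using assms by (simp add: is_free_gibbs_measure_def)
  interpret G: real_distribution \<nu>\<^sub>g using assms by (simp add: is_free_gibbs_measure_def)
  have f: "f \<in> borel_measurable borel" and g: "g \<in> borel_measurable borel"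
    using assms by (auto intro: borel_measurable_continuous_onI)
  have dual': "g x + f y \<ge> x * y" for x y using assms(4)[of y x] by (simp add: algebra_simps)
  note finF = F.free_entropy_pot_finiteD[OF f dual_growth[of f g, OF assms(4)]]
    and finG = G.free_entropy_pot_finiteD[OF g dual_growth[of g f, OF dual']]
  show ?thesis
  proof (cases "free_entropy_pot f \<nu>\<^sub>f = - \<infinity> \<or> free_entropy_pot g \<nu>\<^sub>g = - \<infinity>")
    case True
    \<comment> \<open>In \<open>ereal\<close>, \<open>\<infinity> + (- \<infinity>)\<close> is
      \<open>\<infinity>\<close>, so the value \<open>\<infinity>\<close> has to be excluded before
      the sum can be called \<open>- \<infinity>\<close>.\<close>
    moreover have "free_entropy_pot f \<nu>\<^sub>f \<noteq> \<infinity>" "free_entropy_pot g \<nu>\<^sub>g \<noteq> \<infinity>"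
      using finF(4) finG(4) by force+
    ultimately have sum: "free_entropy_pot f \<nu>\<^sub>f + free_entropy_pot g \<nu>\<^sub>g = - \<infinity>" by auto
    show ?thesis
      unfolding sum exp_ereal_def MInfty_eq_minfinity[symmetric] ereal.case by simp
  next
    case False
    then have f_fin: "free_entropy_pot f \<nu>\<^sub>f \<noteq> - \<infinity>" and g_fin: "free_entropy_pot g \<nu>\<^sub>g \<noteq> - \<infinity>"
      by auto
    note F' = finF[OF f_fin] and G' = finG[OF g_fin]
    let ?F = "\<lambda>n. uniform_measure \<nu>\<^sub>f {- real n..real n}"
      and ?G = "\<lambda>n. uniform_measure \<nu>\<^sub>g {- real n..real n}"
    \<comment> \<open>Conditioning needs an interval of positive mass under both measures, which
      holds for all large \<open>n\<close>.\<close>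
    have "eventually (\<lambda>n. log_energy (?F n) + log_energy (?G n) + 3 / 2
        \<le> (\<integral>x. f x \<partial>?F n) + (\<integral>x. g x \<partial>?G n) - (\<integral>x. x \<partial>?F n) * (\<integral>x. x \<partial>?G n)) sequentially"
      using F.conditioning_tendsto(1) G.conditioning_tendsto(1)
    proof eventually_elim
      case (elim n)
      note cF = F.conditioning[OF elim(1)] and cG = G.conditioning[OF elim(2)]
      show ?case
        by (rule log_energy_sum_le[OF talagrand assms(2,3,4) cF(1,2) cF(3)[OF F'(3)]
              cG(1,2) cG(3)[OF G'(3)]])
    qed
    moreover have "(\<lambda>n. log_energy (?F n) + log_energy (?G n) + 3 / 2)
        \<longlonglongrightarrow> log_energy \<nu>\<^sub>f + log_energy \<nu>\<^sub>g + 3 / 2"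
      by (intro tendsto_add F.conditioning_tendsto(3) G.conditioning_tendsto(3) F' G' tendsto_const)
    moreover have "(\<lambda>n. (\<integral>x. f x \<partial>?F n) + (\<integral>x. g x \<partial>?G n) - (\<integral>x. x \<partial>?F n) * (\<integral>x. x \<partial>?G n))
        \<longlonglongrightarrow> (\<integral>x. f x \<partial>\<nu>\<^sub>f) + (\<integral>x. g x \<partial>\<nu>\<^sub>g) - (\<integral>x. x \<partial>\<nu>\<^sub>f) * (\<integral>x. x \<partial>\<nu>\<^sub>g)"
      by (intro tendsto_add tendsto_diff tendsto_mult
          F.conditioning_tendsto(2) G.conditioning_tendsto(2) F' G')
    ultimately have "log_energy \<nu>\<^sub>f + log_energy \<nu>\<^sub>g + 3 / 2
        \<le> (\<integral>x. f x \<partial>\<nu>\<^sub>f) + (\<integral>x. g x \<partial>\<nu>\<^sub>g) - (\<integral>x. x \<partial>\<nu>\<^sub>f) * (\<integral>x. x \<partial>\<nu>\<^sub>g)"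
      by (intro tendsto_le[OF sequentially_bot])
    \<comment> \<open>A single vanishing barycenter kills the product, whichever of the two measures
      is centered.\<close>
    also have "(\<integral>x. x \<partial>\<nu>\<^sub>f) * (\<integral>x. x \<partial>\<nu>\<^sub>g) = 0"
      using assms(7) by (auto simp: centered_def)
    \<comment> \<open>The two constants \<open>3 / 4\<close> make up the \<open>3 / 2\<close>, and
      the two halves of \<open>ln (2 * pi)\<close> form the right-hand side.\<close>
    finally have "log_energy \<nu>\<^sub>f + 3 / 4 + ln (2 * pi) / 2 - (\<integral>x. f x \<partial>\<nu>\<^sub>f)
        + (log_energy \<nu>\<^sub>g + 3 / 4 + ln (2 * pi) / 2 - (\<integral>x. g x \<partial>\<nu>\<^sub>g)) \<le> ln (2 * pi)"
      (is "?r \<le> _") by (simp add: field_simps)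
    then have "exp ?r \<le> exp (ln (2 * pi))" by (simp only: exp_le_cancel_iff)
    then have "exp ?r \<le> 2 * pi" by (simp only: exp_ln pi_gt_zero mult_pos_pos zero_less_numeral)
    then show ?thesis
      unfolding F'(4) G'(4) exp_ereal_def plus_ereal.simps ereal.case ereal_less_eq .
  qed
qed

end
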